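(* Let $e_0,e_3,e_4\in\mathbb{C}^*$ satisfy $e_0\neq\pm1$, $e_3\neq\pm1$, $e_4\neq\pm1$ and $e_0e_3^{\varepsilon_3}e_4^{\varepsilon_4}\neq1$ for all $\varepsilon_3,\varepsilon_4\in\{1,-1\}$, and let $(y_k,z_k)_{k\in\mathbb{Z}}$ be the log-canonical sequence of functions on the cubic surface $\mathcal{C}_V(\theta)$ defined in the context. Let $P,Q_1,Q_2\in\mathbb{Z}[e_0^{\pm1},e_3^{\pm1},e_4^{\pm1}][t]$ be $$P(t)=t+e_0,$$ $$Q_1(t)=(t-e_0e_4^{-1})(t-e_0e_4)(t-e_3^{-1})(t-e_3),$$ $$Q_2(t)=(t-e_0e_3^{-1})(t-e_0e_3)(t-e_4^{-1})(t-e_4).$$ Then for all $k\in\mathbb{Z}$, $$y_ky_{k+1}=P(z_k),\qquad z_{2k}z_{2k+1}=Q_1(y_{2k+1}),\qquad z_{2k+1}z_{2k+2}=Q_2(y_{2k+2}).$$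
   Context: $a_3=e_3+e_3^{-1}$, $a_4=e_4+e_4^{-1}$, $\theta_1=a_3+e_0a_4$, $\theta_2=a_4+e_0a_3$, $\theta_3=e_0$, $\theta_4=e_0^2+e_0a_3a_4+1$; $\mathcal{C}_V(\theta)\subset\mathbb{C}^3$ is the surface $x_1x_2x_3+x_1^2+x_2^2-\theta_1x_1-\theta_2x_2-\theta_3x_3+\theta_4=0$. For a map $f$ and a function $u$, $f^*u=u\circ f$. The maps $\sigma_1(x_1,x_2,x_3)=(-x_1-x_2x_3+\theta_1,x_2,x_3)$ and $\sigma_2(x_1,x_2,x_3)=(x_1,-x_2-x_1x_3+\theta_2,x_3)$ are involutive automorphisms of $\mathcal{C}_V(\theta)$; $g=\sigma_1\circ\sigma_2$. The sequence: $y_1=x_1$, $z_1=x_1x_2-e_0$, $y_2=x_2$; $(y_2,z_2,y_3)=(\sigma_1^*y_2,\sigma_1^*z_1,\sigma_1^*y_1)$; $(y_0,z_0,y_1)=(\sigma_2^*y_2,\sigma_2^*z_1,\sigma_2^*y_1)$; and for all $k\in\mathbb{Z}$, $(y_{2k},z_{2k},y_{2k+1},z_{2k+1},y_{2k+2},z_{2k+2},y_{2k+3})=(g^{-k})^*(y_0,z_0,y_1,z_1,y_2,z_2,y_3)$ (these prescriptions are consistent; in particular $y_{n+2}=(g^{-1})^*y_n$, $z_{n+2}=(g^{-1})^*z_n$). *)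

theory Defs
  imports Complex_Main "HOL-Library.FuncSet" "HOL-Algebra.Bij"
    "HOL-Computational_Algebra.Polynomial"
begin

type_synonym params = "complex \<times> complex \<times> complex \<times> complex"
type_synonym point = "complex \<times> complex \<times> complex"

definition theta :: "complex \<Rightarrow> complex \<Rightarrow> complex \<Rightarrow> params" where
  "theta e\<^sub>0 e\<^sub>3 e\<^sub>4 =
    (let a\<^sub>3 = e\<^sub>3 + inverse e\<^sub>3; a\<^sub>4 = e\<^sub>4 + inverse e\<^sub>4
     in (a\<^sub>3 + e\<^sub>0 * a\<^sub>4, a\<^sub>4 + e\<^sub>0 * a\<^sub>3, e\<^sub>0, e\<^sub>0\<^sup>2 + e\<^sub>0 * a\<^sub>3 * a\<^sub>4 + 1))"

definition cubic_surface :: "params \<Rightarrow> point set" where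
  "cubic_surface = (\<lambda>(\<theta>\<^sub>1, \<theta>\<^sub>2, \<theta>\<^sub>3, \<theta>\<^sub>4).
    {(x\<^sub>1, x\<^sub>2, x\<^sub>3).
      x\<^sub>1 * x\<^sub>2 * x\<^sub>3 + x\<^sub>1\<^sup>2 + x\<^sub>2\<^sup>2 - \<theta>\<^sub>1 * x\<^sub>1 - \<theta>\<^sub>2 * x\<^sub>2 - \<theta>\<^sub>3 * x\<^sub>3 + \<theta>\<^sub>4 = 0})"

text \<open>Self-maps of the surface and functions on it are extensional (\<^const>\<open>undefined\<close> off the
  surface), so that self-bijections are the elements of the group \<^term>\<open>BijGroup (cubic_surface \<theta>)\<close>.\<close>

definition sigma1 :: "params \<Rightarrow> point \<Rightarrow> point" where
  "sigma1 \<theta> = restrict (\<lambda>(x\<^sub>1, x\<^sub>2, x\<^sub>3). (- x\<^sub>1 - x\<^sub>2 * x\<^sub>3 + fst \<theta>, x\<^sub>2, x\<^sub>3)) (cubic_surface \<theta>)"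

definition sigma2 :: "params \<Rightarrow> point \<Rightarrow> point" where
  "sigma2 \<theta> = restrict (\<lambda>(x\<^sub>1, x\<^sub>2, x\<^sub>3). (x\<^sub>1, - x\<^sub>2 - x\<^sub>1 * x\<^sub>3 + fst (snd \<theta>), x\<^sub>3)) (cubic_surface \<theta>)"

definition gmap :: "params \<Rightarrow> point \<Rightarrow> point" where
  "gmap \<theta> = compose (cubic_surface \<theta>) (sigma1 \<theta>) (sigma2 \<theta>)"

definition pullback :: "params \<Rightarrow> (point \<Rightarrow> point) \<Rightarrow> (point \<Rightarrow> complex) \<Rightarrow> (point \<Rightarrow> complex)" where
  "pullback \<theta> f u = compose (cubic_surface \<theta>) u f"

definition gpow :: "params \<Rightarrow> int \<Rightarrow> point \<Rightarrow> point" where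
  "gpow \<theta> k = gmap \<theta> [^]\<^bsub>BijGroup (cubic_surface \<theta>)\<^esub> k"

definition y1_init :: "params \<Rightarrow> point \<Rightarrow> complex" where
  "y1_init \<theta> = restrict (\<lambda>(x\<^sub>1, x\<^sub>2, x\<^sub>3). x\<^sub>1) (cubic_surface \<theta>)"

definition y2_init :: "params \<Rightarrow> point \<Rightarrow> complex" where
  "y2_init \<theta> = restrict (\<lambda>(x\<^sub>1, x\<^sub>2, x\<^sub>3). x\<^sub>2) (cubic_surface \<theta>)"

definition z1_init :: "complex \<Rightarrow> params \<Rightarrow> point \<Rightarrow> complex" where
  "z1_init e\<^sub>0 \<theta> = restrict (\<lambda>(x\<^sub>1, x\<^sub>2, x\<^sub>3). x\<^sub>1 * x\<^sub>2 - e\<^sub>0) (cubic_surface \<theta>)"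

text \<open>The prescriptions for the sequence overlap. \<open>yseq\<close> and \<open>zseq\<close> use only those for the indices
  0 and 1 together with the action of the powers of \<open>g\<close>; the lemmas \<open>log_canonical_init\<close>,
  \<open>log_canonical_sigma1\<close>, \<open>log_canonical_sigma2\<close>, \<open>yseq_gpow\<close> and \<open>zseq_gpow\<close> below show that all of them hold.\<close>

definition yseq :: "complex \<Rightarrow> complex \<Rightarrow> complex \<Rightarrow> int \<Rightarrow> point \<Rightarrow> complex" where
  "yseq e\<^sub>0 e\<^sub>3 e\<^sub>4 n =
    (let \<theta> = theta e\<^sub>0 e\<^sub>3 e\<^sub>4
     in pullback \<theta> (gpow \<theta> (- (n div 2)))
          (if even n then pullback \<theta> (sigma2 \<theta>) (y2_init \<theta>) else y1_init \<theta>))"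

definition zseq :: "complex \<Rightarrow> complex \<Rightarrow> complex \<Rightarrow> int \<Rightarrow> point \<Rightarrow> complex" where
  "zseq e\<^sub>0 e\<^sub>3 e\<^sub>4 n =
    (let \<theta> = theta e\<^sub>0 e\<^sub>3 e\<^sub>4
     in pullback \<theta> (gpow \<theta> (- (n div 2)))
          (if even n then pullback \<theta> (sigma2 \<theta>) (z1_init e\<^sub>0 \<theta>) else z1_init e\<^sub>0 \<theta>))"

definition P :: "complex \<Rightarrow> complex poly" where
  "P e\<^sub>0 = [:e\<^sub>0, 1:]"

definition Q1 :: "complex \<Rightarrow> complex \<Rightarrow> complex \<Rightarrow> complex poly" where
  "Q1 e\<^sub>0 e\<^sub>3 e\<^sub>4 =
    [:- (e\<^sub>0 * inverse e\<^sub>4), 1:] * [:- (e\<^sub>0 * e\<^sub>4), 1:] * [:- inverse e\<^sub>3, 1:] * [:- e\<^sub>3, 1:]"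

definition Q2 :: "complex \<Rightarrow> complex \<Rightarrow> complex \<Rightarrow> complex poly" where
  "Q2 e\<^sub>0 e\<^sub>3 e\<^sub>4 =
    [:- (e\<^sub>0 * inverse e\<^sub>3), 1:] * [:- (e\<^sub>0 * e\<^sub>3), 1:] * [:- inverse e\<^sub>4, 1:] * [:- e\<^sub>4, 1:]"

lemma sigma1_involution:
  assumes "p \<in> cubic_surface \<theta>"
  shows "sigma1 \<theta> p \<in> cubic_surface \<theta>" "sigma1 \<theta> (sigma1 \<theta> p) = p"
proof -
  show *: "sigma1 \<theta> p \<in> cubic_surface \<theta>"
    using assms unfolding cubic_surface_def sigma1_def
    by (cases \<theta>; cases p) (simp add: power2_eq_square algebra_simps)
  show "sigma1 \<theta> (sigma1 \<theta> p) = p"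
    using assms * unfolding sigma1_def by (cases p) simp
qed

lemma sigma2_involution:
  assumes "p \<in> cubic_surface \<theta>"
  shows "sigma2 \<theta> p \<in> cubic_surface \<theta>" "sigma2 \<theta> (sigma2 \<theta> p) = p"
proof -
  show *: "sigma2 \<theta> p \<in> cubic_surface \<theta>"
    using assms unfolding cubic_surface_def sigma2_def
    by (cases \<theta>; cases p) (simp add: power2_eq_square algebra_simps)
  show "sigma2 \<theta> (sigma2 \<theta> p) = p"
    using assms * unfolding sigma2_def by (cases p) simp
qed

lemma involution_Bij:
  assumes "f \<in> extensional S" "\<And>p. p \<in> S \<Longrightarrow> f p \<in> S" "\<And>p. p \<in> S \<Longrightarrow> f (f p) = p"
  shows "f \<in> Bij S"
  unfolding Bij_def using assms by (auto intro: bij_betw_byWitness[where f' = f])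

lemma sigma1_Bij: "sigma1 \<theta> \<in> Bij (cubic_surface \<theta>)"
  by (rule involution_Bij) (auto simp: sigma1_involution, simp add: sigma1_def)

lemma sigma2_Bij: "sigma2 \<theta> \<in> Bij (cubic_surface \<theta>)"
  by (rule involution_Bij) (auto simp: sigma2_involution, simp add: sigma2_def)

lemma gmap_Bij: "gmap \<theta> \<in> Bij (cubic_surface \<theta>)"
  by (simp add: gmap_def compose_Bij sigma1_Bij sigma2_Bij)

lemma BijGroup_simps:
  "carrier (BijGroup S) = Bij S"
  "\<one>\<^bsub>BijGroup S\<^esub> = (\<lambda>x \<in> S. x)"
  "f \<in> Bij S \<Longrightarrow> h \<in> Bij S \<Longrightarrow> f \<otimes>\<^bsub>BijGroup S\<^esub> h = compose S f h"
  by (simp_all add: BijGroup_def)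

lemma gpow_Bij: "gpow \<theta> k \<in> Bij (cubic_surface \<theta>)"
  using group.int_pow_closed[OF group_BijGroup, of "gmap \<theta>" "cubic_surface \<theta>" k]
  unfolding gpow_def BijGroup_simps by (simp only: gmap_Bij)

lemma gpow_add: "gpow \<theta> (j + k) = compose (cubic_surface \<theta>) (gpow \<theta> j) (gpow \<theta> k)"
proof -
  have "gpow \<theta> (j + k) = gpow \<theta> j \<otimes>\<^bsub>BijGroup (cubic_surface \<theta>)\<^esub> gpow \<theta> k"
    unfolding gpow_def by (rule group.int_pow_mult[OF group_BijGroup]) (simp only: BijGroup_simps gmap_Bij)
  then show ?thesis by (simp only: BijGroup_simps(3)[OF gpow_Bij gpow_Bij])
qed

lemma gpow_0: "gpow \<theta> 0 = (\<lambda>p \<in> cubic_surface \<theta>. p)"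
  by (simp only: gpow_def int_pow_0 BijGroup_simps)

lemma gpow_1: "gpow \<theta> 1 = gmap \<theta>"
  unfolding gpow_def by (rule group.int_pow_1[OF group_BijGroup]) (simp only: BijGroup_simps gmap_Bij)

lemma gpow_minus_1: "gpow \<theta> (- 1) = compose (cubic_surface \<theta>) (sigma2 \<theta>) (sigma1 \<theta>)"
proof
  fix p
  let ?S = "cubic_surface \<theta>"
  show "gpow \<theta> (- 1) p = compose ?S (sigma2 \<theta>) (sigma1 \<theta>) p"
  proof (cases "p \<in> ?S")
    case True
    let ?q = "compose ?S (sigma2 \<theta>) (sigma1 \<theta>) p"
    have q: "?q \<in> ?S" "gmap \<theta> ?q = p"
      using True by (simp_all add: gmap_def compose_eq sigma1_involution sigma2_involution)
    have "gpow \<theta> (- 1) (gmap \<theta> ?q) = ?q"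
      using fun_cong[OF gpow_add[of \<theta> "- 1" 1], of ?q] q(1)
      by (simp only: gpow_0 gpow_1 compose_eq restrict_apply' add.left_inverse)
    then show ?thesis by (simp only: q(2))
  next
    case False
    then show ?thesis
      using extensional_arb[OF Bij_imp_extensional[OF gpow_Bij]] by (simp add: compose_def)
  qed
qed

lemma pullback_pullback:
  assumes "f \<in> Bij (cubic_surface \<theta>)"
  shows "pullback \<theta> f (pullback \<theta> h u) = pullback \<theta> (compose (cubic_surface \<theta>) h f) u"
  using Bij_imp_funcset[OF assms] by (auto simp: pullback_def compose_def fun_eq_iff)

lemma yseq_gpow: "yseq e\<^sub>0 e\<^sub>3 e\<^sub>4 (2 * k + n) =
    pullback (theta e\<^sub>0 e\<^sub>3 e\<^sub>4) (gpow (theta e\<^sub>0 e\<^sub>3 e\<^sub>4) (- k)) (yseq e\<^sub>0 e\<^sub>3 e\<^sub>4 n)"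
proof -
  have "- ((2 * k + n) div 2) = - (n div 2) + - k" by simp
  moreover have "even (2 * k + n) = even n" by simp
  ultimately show ?thesis
    unfolding yseq_def Let_def by (simp only: pullback_pullback[OF gpow_Bij] gpow_add)
qed

lemma zseq_gpow: "zseq e\<^sub>0 e\<^sub>3 e\<^sub>4 (2 * k + n) =
    pullback (theta e\<^sub>0 e\<^sub>3 e\<^sub>4) (gpow (theta e\<^sub>0 e\<^sub>3 e\<^sub>4) (- k)) (zseq e\<^sub>0 e\<^sub>3 e\<^sub>4 n)"
proof -
  have "- ((2 * k + n) div 2) = - (n div 2) + - k" by simp
  moreover have "even (2 * k + n) = even n" by simp
  ultimately show ?thesis
    unfolding zseq_def Let_def by (simp only: pullback_pullback[OF gpow_Bij] gpow_add)
qed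

lemma pullback_extensional: "pullback \<theta> f u \<in> extensional (cubic_surface \<theta>)"
  by (simp add: pullback_def)

lemma pullback_gpow_0:
  "u \<in> extensional (cubic_surface \<theta>) \<Longrightarrow> pullback \<theta> (gpow \<theta> 0) u = u"
  by (auto simp: pullback_def gpow_0 compose_def fun_eq_iff extensional_def)

lemma pullback_sigma2_sigma2:
  "u \<in> extensional (cubic_surface \<theta>) \<Longrightarrow>
    pullback \<theta> (compose (cubic_surface \<theta>) (sigma2 \<theta>) (compose (cubic_surface \<theta>) (sigma2 \<theta>) (sigma1 \<theta>))) u
      = pullback \<theta> (sigma1 \<theta>) u"
  by (auto simp: pullback_def compose_def fun_eq_iff extensional_def
      sigma1_involution sigma2_involution)

lemma pullback_gpow_minus_1_sigma2:
  "u \<in> extensional (cubic_surface \<theta>) \<Longrightarrow>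
    pullback \<theta> (gpow \<theta> (- 1)) (pullback \<theta> (sigma2 \<theta>) u) = pullback \<theta> (sigma1 \<theta>) u"
  by (simp add: pullback_pullback gpow_Bij) (simp add: gpow_minus_1 pullback_sigma2_sigma2)

lemma init_extensional:
  "y1_init \<theta> \<in> extensional (cubic_surface \<theta>)"
  "y2_init \<theta> \<in> extensional (cubic_surface \<theta>)"
  "z1_init e\<^sub>0 \<theta> \<in> extensional (cubic_surface \<theta>)"
  by (simp_all add: y1_init_def y2_init_def z1_init_def)

lemma pullback_sigma_init:
  "pullback \<theta> (sigma1 \<theta>) (y2_init \<theta>) = y2_init \<theta>"
  "pullback \<theta> (sigma2 \<theta>) (y1_init \<theta>) = y1_init \<theta>"
proof -
  have "pullback \<theta> (sigma1 \<theta>) (y2_init \<theta>) p = y2_init \<theta> p" for p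
    using sigma1_involution(1)[of p \<theta>]
    by (cases p) (auto simp: pullback_def y2_init_def sigma1_def compose_def)
  moreover have "pullback \<theta> (sigma2 \<theta>) (y1_init \<theta>) p = y1_init \<theta> p" for p
    using sigma2_involution(1)[of p \<theta>]
    by (cases p) (auto simp: pullback_def y1_init_def sigma2_def compose_def)
  ultimately show "pullback \<theta> (sigma1 \<theta>) (y2_init \<theta>) = y2_init \<theta>"
    "pullback \<theta> (sigma2 \<theta>) (y1_init \<theta>) = y1_init \<theta>" by auto
qed

lemma pullback_gpow_minus_1_y1:
  "pullback \<theta> (gpow \<theta> (- 1)) (y1_init \<theta>) = pullback \<theta> (sigma1 \<theta>) (y1_init \<theta>)"
  using pullback_gpow_minus_1_sigma2[OF init_extensional(1), of \<theta>]
  by (simp add: pullback_sigma_init)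

lemma log_canonical_init:
  "yseq e\<^sub>0 e\<^sub>3 e\<^sub>4 1 = y1_init (theta e\<^sub>0 e\<^sub>3 e\<^sub>4)"
  "zseq e\<^sub>0 e\<^sub>3 e\<^sub>4 1 = z1_init e\<^sub>0 (theta e\<^sub>0 e\<^sub>3 e\<^sub>4)"
  "yseq e\<^sub>0 e\<^sub>3 e\<^sub>4 2 = y2_init (theta e\<^sub>0 e\<^sub>3 e\<^sub>4)"
  by (simp_all add: yseq_def zseq_def Let_def pullback_gpow_0 init_extensional
      pullback_gpow_minus_1_sigma2 pullback_sigma_init)

lemma log_canonical_sigma1:
  fixes e\<^sub>0 e\<^sub>3 e\<^sub>4 defines "\<theta> \<equiv> theta e\<^sub>0 e\<^sub>3 e\<^sub>4"
  shows "yseq e\<^sub>0 e\<^sub>3 e\<^sub>4 2 = pullback \<theta> (sigma1 \<theta>) (yseq e\<^sub>0 e\<^sub>3 e\<^sub>4 2)"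
    and "zseq e\<^sub>0 e\<^sub>3 e\<^sub>4 2 = pullback \<theta> (sigma1 \<theta>) (zseq e\<^sub>0 e\<^sub>3 e\<^sub>4 1)"
    and "yseq e\<^sub>0 e\<^sub>3 e\<^sub>4 3 = pullback \<theta> (sigma1 \<theta>) (yseq e\<^sub>0 e\<^sub>3 e\<^sub>4 1)"
  unfolding \<theta>_def log_canonical_init
  by (simp_all add: yseq_def zseq_def Let_def init_extensional
      pullback_gpow_minus_1_sigma2 pullback_sigma_init pullback_gpow_minus_1_y1)

lemma log_canonical_sigma2:
  fixes e\<^sub>0 e\<^sub>3 e\<^sub>4 defines "\<theta> \<equiv> theta e\<^sub>0 e\<^sub>3 e\<^sub>4"
  shows "yseq e\<^sub>0 e\<^sub>3 e\<^sub>4 0 = pullback \<theta> (sigma2 \<theta>) (yseq e\<^sub>0 e\<^sub>3 e\<^sub>4 2)"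
    and "zseq e\<^sub>0 e\<^sub>3 e\<^sub>4 0 = pullback \<theta> (sigma2 \<theta>) (zseq e\<^sub>0 e\<^sub>3 e\<^sub>4 1)"
    and "yseq e\<^sub>0 e\<^sub>3 e\<^sub>4 1 = pullback \<theta> (sigma2 \<theta>) (yseq e\<^sub>0 e\<^sub>3 e\<^sub>4 1)"
  unfolding \<theta>_def log_canonical_init
  by (simp_all add: yseq_def zseq_def Let_def pullback_gpow_0 pullback_extensional pullback_sigma_init)

end

theory Submission
  imports Defs
begin

text \<open>The involution \<open>\<sigma>\<^sub>2\<close> is a Vieta involution: it exchanges the two roots of the equation of
  the surface, which is quadratic in \<open>x\<^sub>2\<close>.  So \<open>x\<^sub>2\<close> and \<open>x\<^sub>2' = \<sigma>\<^sub>2\<^sup>* x\<^sub>2\<close> have the sum \<open>\<theta>\<^sub>2 - x\<^sub>1 x\<^sub>3\<close> and the product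
  \<open>x\<^sub>1\<^sup>2 - \<theta>\<^sub>1 x\<^sub>1 - e\<^sub>0 x\<^sub>3 + \<theta>\<^sub>4\<close>.  Since \<open>z\<^sub>0 = x\<^sub>1 x\<^sub>2' - e\<^sub>0\<close> and \<open>z\<^sub>1 = x\<^sub>1 x\<^sub>2 - e\<^sub>0\<close>, the product \<open>z\<^sub>0 z\<^sub>1\<close> is
  symmetric in the two roots.  Because \<open>\<theta>\<^sub>3\<close> equals the constant \<open>e\<^sub>0\<close> in \<open>z\<^sub>1\<close>, the two terms
  \<open>\<plusminus> e\<^sub>0 x\<^sub>1\<^sup>2 x\<^sub>3\<close> of that product cancel.  What remains is a quartic in \<open>x\<^sub>1\<close> alone, and the formulas
  for \<open>\<theta>\<close> say that it is \<open>Q\<^sub>1\<close> (\<open>product_of_adjacent_z\<close>, \<open>quartic_factorization\<close>).  The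
  relation for \<open>z\<^sub>1 z\<^sub>2\<close> comes from \<open>\<sigma>\<^sub>1\<close> in the same way, because exchanging \<open>x\<^sub>1\<close> with \<open>x\<^sub>2\<close> and \<open>e\<^sub>3\<close>
  with \<open>e\<^sub>4\<close> preserves the surface.  The relations for \<open>y\<^sub>k y\<^sub>k\<^sub>+\<^sub>1\<close> merely restate the definition of \<open>z\<^sub>k\<close>.

  Every relation is an identity between functions on the whole surface, so it may be evaluated at
  \<open>g\<^sup>-\<^sup>k p\<close> in place of \<open>p\<close>.  This moves all indices by \<open>2k\<close> (\<open>yseq_shift\<close>, \<open>zseq_shift\<close>) and leaves
  only the indices \<open>0\<close>, \<open>1\<close> and \<open>2\<close> to be checked.\<close>

lemma gpow_in_surface: "p \<in> cubic_surface \<theta> \<Longrightarrow> gpow \<theta> k p \<in> cubic_surface \<theta>"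
  by (rule funcset_mem[OF Bij_imp_funcset[OF gpow_Bij]])

lemma yseq_shift:
  assumes "p \<in> cubic_surface (theta e\<^sub>0 e\<^sub>3 e\<^sub>4)"
  shows "yseq e\<^sub>0 e\<^sub>3 e\<^sub>4 (2 * k + n) p = yseq e\<^sub>0 e\<^sub>3 e\<^sub>4 n (gpow (theta e\<^sub>0 e\<^sub>3 e\<^sub>4) (- k) p)"
  using assms by (simp only: yseq_gpow pullback_def compose_eq)

lemma zseq_shift:
  assumes "p \<in> cubic_surface (theta e\<^sub>0 e\<^sub>3 e\<^sub>4)"
  shows "zseq e\<^sub>0 e\<^sub>3 e\<^sub>4 (2 * k + n) p = zseq e\<^sub>0 e\<^sub>3 e\<^sub>4 n (gpow (theta e\<^sub>0 e\<^sub>3 e\<^sub>4) (- k) p)"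
  using assms by (simp only: zseq_gpow pullback_def compose_eq)

lemma initial_values:
  fixes e\<^sub>0 e\<^sub>3 e\<^sub>4 x\<^sub>1 x\<^sub>2 x\<^sub>3 :: complex
  defines "\<theta> \<equiv> theta e\<^sub>0 e\<^sub>3 e\<^sub>4"
  assumes p: "(x\<^sub>1, x\<^sub>2, x\<^sub>3) \<in> cubic_surface \<theta>"
  shows "yseq e\<^sub>0 e\<^sub>3 e\<^sub>4 0 (x\<^sub>1, x\<^sub>2, x\<^sub>3) = - x\<^sub>2 - x\<^sub>1 * x\<^sub>3 + fst (snd \<theta>)"
    and "zseq e\<^sub>0 e\<^sub>3 e\<^sub>4 0 (x\<^sub>1, x\<^sub>2, x\<^sub>3) = x\<^sub>1 * (- x\<^sub>2 - x\<^sub>1 * x\<^sub>3 + fst (snd \<theta>)) - e\<^sub>0"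
    and "yseq e\<^sub>0 e\<^sub>3 e\<^sub>4 1 (x\<^sub>1, x\<^sub>2, x\<^sub>3) = x\<^sub>1"
    and "zseq e\<^sub>0 e\<^sub>3 e\<^sub>4 1 (x\<^sub>1, x\<^sub>2, x\<^sub>3) = x\<^sub>1 * x\<^sub>2 - e\<^sub>0"
    and "yseq e\<^sub>0 e\<^sub>3 e\<^sub>4 2 (x\<^sub>1, x\<^sub>2, x\<^sub>3) = x\<^sub>2"
    and "zseq e\<^sub>0 e\<^sub>3 e\<^sub>4 2 (x\<^sub>1, x\<^sub>2, x\<^sub>3) = x\<^sub>2 * (- x\<^sub>1 - x\<^sub>2 * x\<^sub>3 + fst \<theta>) - e\<^sub>0"
proof -
  have s1: "sigma1 \<theta> (x\<^sub>1, x\<^sub>2, x\<^sub>3) = (- x\<^sub>1 - x\<^sub>2 * x\<^sub>3 + fst \<theta>, x\<^sub>2, x\<^sub>3)"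
    and s2: "sigma2 \<theta> (x\<^sub>1, x\<^sub>2, x\<^sub>3) = (x\<^sub>1, - x\<^sub>2 - x\<^sub>1 * x\<^sub>3 + fst (snd \<theta>), x\<^sub>3)"
    using p by (simp_all add: sigma1_def sigma2_def)
  have S1: "(- x\<^sub>1 - x\<^sub>2 * x\<^sub>3 + fst \<theta>, x\<^sub>2, x\<^sub>3) \<in> cubic_surface \<theta>"
    and S2: "(x\<^sub>1, - x\<^sub>2 - x\<^sub>1 * x\<^sub>3 + fst (snd \<theta>), x\<^sub>3) \<in> cubic_surface \<theta>"
    using sigma1_involution(1)[OF p] sigma2_involution(1)[OF p] by (simp_all only: s1 s2)
  show "yseq e\<^sub>0 e\<^sub>3 e\<^sub>4 1 (x\<^sub>1, x\<^sub>2, x\<^sub>3) = x\<^sub>1"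
    "zseq e\<^sub>0 e\<^sub>3 e\<^sub>4 1 (x\<^sub>1, x\<^sub>2, x\<^sub>3) = x\<^sub>1 * x\<^sub>2 - e\<^sub>0"
    "yseq e\<^sub>0 e\<^sub>3 e\<^sub>4 2 (x\<^sub>1, x\<^sub>2, x\<^sub>3) = x\<^sub>2"
    using p by (simp_all add: log_canonical_init y1_init_def z1_init_def y2_init_def
        flip: \<theta>_def)
  show "yseq e\<^sub>0 e\<^sub>3 e\<^sub>4 0 (x\<^sub>1, x\<^sub>2, x\<^sub>3) = - x\<^sub>2 - x\<^sub>1 * x\<^sub>3 + fst (snd \<theta>)"
    "zseq e\<^sub>0 e\<^sub>3 e\<^sub>4 0 (x\<^sub>1, x\<^sub>2, x\<^sub>3) = x\<^sub>1 * (- x\<^sub>2 - x\<^sub>1 * x\<^sub>3 + fst (snd \<theta>)) - e\<^sub>0"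
    "zseq e\<^sub>0 e\<^sub>3 e\<^sub>4 2 (x\<^sub>1, x\<^sub>2, x\<^sub>3) = x\<^sub>2 * (- x\<^sub>1 - x\<^sub>2 * x\<^sub>3 + fst \<theta>) - e\<^sub>0"
    using S1 S2 unfolding log_canonical_sigma2(1,2) log_canonical_sigma1(2) log_canonical_init
    by (simp_all add: pullback_def compose_eq p s1 s2 y2_init_def z1_init_def flip: \<theta>_def)
qed

text \<open>Stated for the equation of the surface with arbitrary \<open>\<theta>\<^sub>1\<close>, \<open>\<theta>\<^sub>2\<close>, \<open>\<theta>\<^sub>4\<close> and with \<open>\<theta>\<^sub>3 = c\<close>, so that
  it serves both involutions: the equation is invariant under exchanging the indices \<open>1\<close> and \<open>2\<close>.
  The hypothesis says that the Vieta conjugate \<open>x\<^sub>2'\<close> satisfies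
  \<open>x\<^sub>2 x\<^sub>2' = x\<^sub>1\<^sup>2 - \<theta>\<^sub>1 x\<^sub>1 - c x\<^sub>3 + \<theta>\<^sub>4\<close>; the constant in \<open>x\<^sub>1 x\<^sub>2 - c\<close> is the one that eliminates \<open>x\<^sub>3\<close>.\<close>

lemma product_of_adjacent_z:
  fixes x\<^sub>1 x\<^sub>2 x\<^sub>3 \<theta>\<^sub>1 \<theta>\<^sub>2 \<theta>\<^sub>4 c :: "'a :: comm_ring_1"
  assumes "x\<^sub>1 * x\<^sub>2 * x\<^sub>3 + x\<^sub>1\<^sup>2 + x\<^sub>2\<^sup>2 - \<theta>\<^sub>1 * x\<^sub>1 - \<theta>\<^sub>2 * x\<^sub>2 - c * x\<^sub>3 + \<theta>\<^sub>4 = 0"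
  shows "(x\<^sub>1 * (- x\<^sub>2 - x\<^sub>1 * x\<^sub>3 + \<theta>\<^sub>2) - c) * (x\<^sub>1 * x\<^sub>2 - c)
    = x\<^sub>1 ^ 4 - \<theta>\<^sub>1 * x\<^sub>1 ^ 3 + \<theta>\<^sub>4 * x\<^sub>1\<^sup>2 - c * \<theta>\<^sub>2 * x\<^sub>1 + c\<^sup>2"
proof -
  \<comment> \<open>The factor \<open>x\<^sub>1\<^sup>2\<close> is the coefficient of the product \<open>x\<^sub>2 x\<^sub>2'\<close>, which the equation replaces.\<close>
  have "x\<^sub>1 ^ 4 - \<theta>\<^sub>1 * x\<^sub>1 ^ 3 + \<theta>\<^sub>4 * x\<^sub>1\<^sup>2 - c * \<theta>\<^sub>2 * x\<^sub>1 + c\<^sup>2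
      = (x\<^sub>1 * (- x\<^sub>2 - x\<^sub>1 * x\<^sub>3 + \<theta>\<^sub>2) - c) * (x\<^sub>1 * x\<^sub>2 - c)
        + x\<^sub>1\<^sup>2 * (x\<^sub>1 * x\<^sub>2 * x\<^sub>3 + x\<^sub>1\<^sup>2 + x\<^sub>2\<^sup>2 - \<theta>\<^sub>1 * x\<^sub>1 - \<theta>\<^sub>2 * x\<^sub>2 - c * x\<^sub>3 + \<theta>\<^sub>4)"
    by (simp add: algebra_simps power2_eq_square power3_eq_cube power4_eq_xxxx)
  with assms show ?thesis by simp
qed

text \<open>The roots come in two pairs: \<open>c b\<^sup>\<plusminus>\<^sup>1\<close> with product \<open>c\<^sup>2\<close> and \<open>a\<^sup>\<plusminus>\<^sup>1\<close> with product \<open>1\<close>.  The quartic is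
  the product of the two quadratics \<open>t\<^sup>2 - c (b + b\<^sup>-\<^sup>1) t + c\<^sup>2\<close> and \<open>t\<^sup>2 - (a + a\<^sup>-\<^sup>1) t + 1\<close>, and its
  coefficients are the values prescribed for \<open>\<theta>\<close>.\<close>

lemma quartic_factorization:
  fixes a b c t :: "'a :: field"
  assumes "a \<noteq> 0" "b \<noteq> 0"
  defines "A \<equiv> a + inverse a" and "B \<equiv> b + inverse b"
  shows "t ^ 4 - (A + c * B) * t ^ 3 + (c\<^sup>2 + c * A * B + 1) * t\<^sup>2 - c * (B + c * A) * t + c\<^sup>2
    = (t - c * inverse b) * (t - c * b) * (t - inverse a) * (t - a)"
proof -
  have "(t - c * inverse b) * (t - c * b) = t\<^sup>2 - c * B * t + c\<^sup>2 * (b * inverse b)"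
    unfolding B_def by (simp add: algebra_simps power2_eq_square)
  moreover have "(t - inverse a) * (t - a) = t\<^sup>2 - A * t + a * inverse a"
    unfolding A_def by (simp add: algebra_simps power2_eq_square)
  ultimately have "(t - c * inverse b) * (t - c * b) * (t - inverse a) * (t - a)
      = (t\<^sup>2 - c * B * t + c\<^sup>2) * (t\<^sup>2 - A * t + 1)"
    using assms(1,2) by (simp add: mult.assoc)
  then show ?thesis
    by (simp add: algebra_simps power2_eq_square power3_eq_cube power4_eq_xxxx)
qed

lemma relations_at_initial_indices:
  fixes e\<^sub>0 e\<^sub>3 e\<^sub>4 :: complex
  assumes e: "e\<^sub>3 \<noteq> 0" "e\<^sub>4 \<noteq> 0" and p: "p \<in> cubic_surface (theta e\<^sub>0 e\<^sub>3 e\<^sub>4)"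
  shows "yseq e\<^sub>0 e\<^sub>3 e\<^sub>4 0 p * yseq e\<^sub>0 e\<^sub>3 e\<^sub>4 1 p = poly (P e\<^sub>0) (zseq e\<^sub>0 e\<^sub>3 e\<^sub>4 0 p)"
    and "yseq e\<^sub>0 e\<^sub>3 e\<^sub>4 1 p * yseq e\<^sub>0 e\<^sub>3 e\<^sub>4 2 p = poly (P e\<^sub>0) (zseq e\<^sub>0 e\<^sub>3 e\<^sub>4 1 p)"
    and "zseq e\<^sub>0 e\<^sub>3 e\<^sub>4 0 p * zseq e\<^sub>0 e\<^sub>3 e\<^sub>4 1 p = poly (Q1 e\<^sub>0 e\<^sub>3 e\<^sub>4) (yseq e\<^sub>0 e\<^sub>3 e\<^sub>4 1 p)"
    and "zseq e\<^sub>0 e\<^sub>3 e\<^sub>4 1 p * zseq e\<^sub>0 e\<^sub>3 e\<^sub>4 2 p = poly (Q2 e\<^sub>0 e\<^sub>3 e\<^sub>4) (yseq e\<^sub>0 e\<^sub>3 e\<^sub>4 2 p)"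
proof -
  obtain x\<^sub>1 x\<^sub>2 x\<^sub>3 where px: "p = (x\<^sub>1, x\<^sub>2, x\<^sub>3)" by (cases p)
  note val = initial_values[OF p[unfolded px], folded px]
  define A where "A = e\<^sub>3 + inverse e\<^sub>3"
  define B where "B = e\<^sub>4 + inverse e\<^sub>4"
  have th: "theta e\<^sub>0 e\<^sub>3 e\<^sub>4 = (A + e\<^sub>0 * B, B + e\<^sub>0 * A, e\<^sub>0, e\<^sub>0\<^sup>2 + e\<^sub>0 * A * B + 1)"
    by (simp add: theta_def A_def B_def Let_def)
  have eq: "x\<^sub>1 * x\<^sub>2 * x\<^sub>3 + x\<^sub>1\<^sup>2 + x\<^sub>2\<^sup>2 - (A + e\<^sub>0 * B) * x\<^sub>1 - (B + e\<^sub>0 * A) * x\<^sub>2 - e\<^sub>0 * x\<^sub>3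
      + (e\<^sub>0\<^sup>2 + e\<^sub>0 * A * B + 1) = 0"
    using p unfolding px th cubic_surface_def by simp
  have eq': "x\<^sub>2 * x\<^sub>1 * x\<^sub>3 + x\<^sub>2\<^sup>2 + x\<^sub>1\<^sup>2 - (B + e\<^sub>0 * A) * x\<^sub>2 - (A + e\<^sub>0 * B) * x\<^sub>1 - e\<^sub>0 * x\<^sub>3
      + (e\<^sub>0\<^sup>2 + e\<^sub>0 * B * A + 1) = 0"
    using eq by (simp add: algebra_simps)
  show "yseq e\<^sub>0 e\<^sub>3 e\<^sub>4 0 p * yseq e\<^sub>0 e\<^sub>3 e\<^sub>4 1 p = poly (P e\<^sub>0) (zseq e\<^sub>0 e\<^sub>3 e\<^sub>4 0 p)"
    "yseq e\<^sub>0 e\<^sub>3 e\<^sub>4 1 p * yseq e\<^sub>0 e\<^sub>3 e\<^sub>4 2 p = poly (P e\<^sub>0) (zseq e\<^sub>0 e\<^sub>3 e\<^sub>4 1 p)"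
    unfolding val P_def by simp_all
  have "zseq e\<^sub>0 e\<^sub>3 e\<^sub>4 0 p * zseq e\<^sub>0 e\<^sub>3 e\<^sub>4 1 p
      = (x\<^sub>1 - e\<^sub>0 * inverse e\<^sub>4) * (x\<^sub>1 - e\<^sub>0 * e\<^sub>4) * (x\<^sub>1 - inverse e\<^sub>3) * (x\<^sub>1 - e\<^sub>3)"
    unfolding val th fst_conv snd_conv product_of_adjacent_z[OF eq]
    unfolding A_def B_def quartic_factorization[OF e] ..
  then show "zseq e\<^sub>0 e\<^sub>3 e\<^sub>4 0 p * zseq e\<^sub>0 e\<^sub>3 e\<^sub>4 1 p = poly (Q1 e\<^sub>0 e\<^sub>3 e\<^sub>4) (yseq e\<^sub>0 e\<^sub>3 e\<^sub>4 1 p)"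
    by (simp add: val(3) Q1_def poly_mult algebra_simps del: mult_pCons_left mult_pCons_right)
  have "zseq e\<^sub>0 e\<^sub>3 e\<^sub>4 2 p * zseq e\<^sub>0 e\<^sub>3 e\<^sub>4 1 p
      = (x\<^sub>2 - e\<^sub>0 * inverse e\<^sub>3) * (x\<^sub>2 - e\<^sub>0 * e\<^sub>3) * (x\<^sub>2 - inverse e\<^sub>4) * (x\<^sub>2 - e\<^sub>4)"
    unfolding val th fst_conv snd_conv mult.commute[of x\<^sub>1 x\<^sub>2] product_of_adjacent_z[OF eq']
    unfolding A_def B_def quartic_factorization[OF e(2,1)] ..
  then show "zseq e\<^sub>0 e\<^sub>3 e\<^sub>4 1 p * zseq e\<^sub>0 e\<^sub>3 e\<^sub>4 2 p = poly (Q2 e\<^sub>0 e\<^sub>3 e\<^sub>4) (yseq e\<^sub>0 e\<^sub>3 e\<^sub>4 2 p)"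
    by (simp add: val(5) Q2_def poly_mult algebra_simps del: mult_pCons_left mult_pCons_right)
qed

theorem proposition3p27:
  fixes e\<^sub>0 e\<^sub>3 e\<^sub>4 :: complex
  assumes "e\<^sub>0 \<noteq> 0" and "e\<^sub>3 \<noteq> 0" and "e\<^sub>4 \<noteq> 0"
    and "e\<^sub>0 \<noteq> 1" and "e\<^sub>0 \<noteq> - 1"
    and "e\<^sub>3 \<noteq> 1" and "e\<^sub>3 \<noteq> - 1"
    and "e\<^sub>4 \<noteq> 1" and "e\<^sub>4 \<noteq> - 1"
    and "\<And>\<epsilon>\<^sub>3 \<epsilon>\<^sub>4 :: int. \<epsilon>\<^sub>3 \<in> {1, - 1} \<Longrightarrow> \<epsilon>\<^sub>4 \<in> {1, - 1} \<Longrightarrow>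
           e\<^sub>0 * (e\<^sub>3 powi \<epsilon>\<^sub>3) * (e\<^sub>4 powi \<epsilon>\<^sub>4) \<noteq> 1"
  shows "\<forall>k :: int. \<forall>p \<in> cubic_surface (theta e\<^sub>0 e\<^sub>3 e\<^sub>4).
      yseq e\<^sub>0 e\<^sub>3 e\<^sub>4 k p * yseq e\<^sub>0 e\<^sub>3 e\<^sub>4 (k + 1) p = poly (P e\<^sub>0) (zseq e\<^sub>0 e\<^sub>3 e\<^sub>4 k p) \<and>
      zseq e\<^sub>0 e\<^sub>3 e\<^sub>4 (2 * k) p * zseq e\<^sub>0 e\<^sub>3 e\<^sub>4 (2 * k + 1) p
        = poly (Q1 e\<^sub>0 e\<^sub>3 e\<^sub>4) (yseq e\<^sub>0 e\<^sub>3 e\<^sub>4 (2 * k + 1) p) \<and>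
      zseq e\<^sub>0 e\<^sub>3 e\<^sub>4 (2 * k + 1) p * zseq e\<^sub>0 e\<^sub>3 e\<^sub>4 (2 * k + 2) p
        = poly (Q2 e\<^sub>0 e\<^sub>3 e\<^sub>4) (yseq e\<^sub>0 e\<^sub>3 e\<^sub>4 (2 * k + 2) p)"
proof (intro allI ballI conjI)
  fix k :: int and p
  assume p: "p \<in> cubic_surface (theta e\<^sub>0 e\<^sub>3 e\<^sub>4)"
  \<comment> \<open>The summand \<open>0\<close> gives every index the form \<open>2 * j + n\<close>, so that the shift rewrites all of them.\<close>
  have rel: "yseq e\<^sub>0 e\<^sub>3 e\<^sub>4 (2 * j + 0) p * yseq e\<^sub>0 e\<^sub>3 e\<^sub>4 (2 * j + 1) p
        = poly (P e\<^sub>0) (zseq e\<^sub>0 e\<^sub>3 e\<^sub>4 (2 * j + 0) p)"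
      "yseq e\<^sub>0 e\<^sub>3 e\<^sub>4 (2 * j + 1) p * yseq e\<^sub>0 e\<^sub>3 e\<^sub>4 (2 * j + 2) p
        = poly (P e\<^sub>0) (zseq e\<^sub>0 e\<^sub>3 e\<^sub>4 (2 * j + 1) p)"
      "zseq e\<^sub>0 e\<^sub>3 e\<^sub>4 (2 * j + 0) p * zseq e\<^sub>0 e\<^sub>3 e\<^sub>4 (2 * j + 1) p
        = poly (Q1 e\<^sub>0 e\<^sub>3 e\<^sub>4) (yseq e\<^sub>0 e\<^sub>3 e\<^sub>4 (2 * j + 1) p)"
      "zseq e\<^sub>0 e\<^sub>3 e\<^sub>4 (2 * j + 1) p * zseq e\<^sub>0 e\<^sub>3 e\<^sub>4 (2 * j + 2) p
        = poly (Q2 e\<^sub>0 e\<^sub>3 e\<^sub>4) (yseq e\<^sub>0 e\<^sub>3 e\<^sub>4 (2 * j + 2) p)" for j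
    unfolding yseq_shift[OF p] zseq_shift[OF p]
    by (rule relations_at_initial_indices[OF assms(2,3) gpow_in_surface[OF p]])+
  show "yseq e\<^sub>0 e\<^sub>3 e\<^sub>4 k p * yseq e\<^sub>0 e\<^sub>3 e\<^sub>4 (k + 1) p = poly (P e\<^sub>0) (zseq e\<^sub>0 e\<^sub>3 e\<^sub>4 k p)"
  proof (cases "even k")
    case True
    then obtain j where "k = 2 * j" by (elim evenE)
    then show ?thesis using rel(1)[of j] by simp
  next
    case False
    then obtain j where "k = 2 * j + 1" by (elim oddE)
    then show ?thesis using rel(2)[of j] by (simp add: add.commute)
  qed
  show "zseq e\<^sub>0 e\<^sub>3 e\<^sub>4 (2 * k) p * zseq e\<^sub>0 e\<^sub>3 e\<^sub>4 (2 * k + 1) p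
      = poly (Q1 e\<^sub>0 e\<^sub>3 e\<^sub>4) (yseq e\<^sub>0 e\<^sub>3 e\<^sub>4 (2 * k + 1) p)"
    using rel(3)[of k] by simp
  show "zseq e\<^sub>0 e\<^sub>3 e\<^sub>4 (2 * k + 1) p * zseq e\<^sub>0 e\<^sub>3 e\<^sub>4 (2 * k + 2) p
      = poly (Q2 e\<^sub>0 e\<^sub>3 e\<^sub>4) (yseq e\<^sub>0 e\<^sub>3 e\<^sub>4 (2 * k + 2) p)"
    by (rule rel(4))
qed

end
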